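(* Let $p\in\mathbb{N}$, let $m_1,\dots,m_p\in\mathbb{N}$, and let $(M_{m_j}(t),N_{m_j}(t))$, $j=1,\dots,p$, be Luchko pairs of kernels from the Luchko sets $L_{m_j}$. Put $$\eta=\sum_{j=1}^{p} m_j, \quad M_{\{m\},\eta}(t) = \left(M_{m_1} * \dots * M_{m_p}\right)(t), \quad N_{\{m\},\eta}(t) = \left(N_{m_1} * \dots * N_{m_p}\right)(t),$$ and let $n,l\in\mathbb{N}$ satisfy $1\le\eta\le n-1$ and $\eta+1\le l\le n-1$. Then the pair of kernels $$M_{\{m\},n-l}(t) = \left(\{1\}^{n-l} * M_{\{m\},\eta}\right)(t), \quad N_{\{m\},l-\eta}(t) = \left(\{1\}^{l-\eta} * N_{\{m\},\eta}\right)(t)$$ belongs to the Luchko set $L_n$.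
   Context: $C_{-1}(0,\infty)$ is the space of functions $f$ on $(0,\infty)$ that can be represented as $f(t)=t^p g(t)$ for $t>0$ with some real $p>-1$ and $g\in C[0,\infty)$. The symbol $*$ denotes the Laplace convolution $(f*g)(t)=\int_0^t f(t-\tau)g(\tau)\,d\tau$, $t>0$. $\{1\}$ is the function identically equal to $1$, and for $n\in\mathbb{N}$, $\{1\}^n$ is its $n$-fold convolution power, $\{1\}^n=h_n(t)=\frac{t^{n-1}}{(n-1)!}$. For $n\in\mathbb{N}$, the Luchko set $L_n$ is the set of pairs $(M(t),N(t))$ (Luchko pairs) with $M,N\in C_{-1}(0,\infty)$ such that $(M*N)(t)=\{1\}^n$ for all $t\in(0,\infty)$. The pairs are indexed by $j$: if $m_i=m_j$ for $i\ne j$, the pairs $(M_{m_i},N_{m_i})$ and $(M_{m_j},N_{m_j})$ need not coincide. *)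

theory Defs
  imports "HOL-Analysis.Analysis"
begin

text \<open>
  Functions on the half-line $(0,\infty)$ are represented by total functions on the reals; no
  definition below depends on their values at arguments \<open>t \<le> 0\<close>, and
  equality of functions always means equality for all \<open>t > 0\<close>.
\<close>

definition C_minus_one :: "(real \<Rightarrow> real) set" where
  "C_minus_one = {f. \<exists>q g. q > -1 \<and> continuous_on {0..} g \<and> (\<forall>t>0. f t = t powr q * g t)}"

text \<open>
  The open interval keeps both \<open>t - \<tau>\<close> and \<open>\<tau>\<close> inside $(0,\infty)$.
\<close>

definition lconv :: "(real \<Rightarrow> real) \<Rightarrow> (real \<Rightarrow> real) \<Rightarrow> real \<Rightarrow> real" where
  "lconv f g t = (LINT \<tau>:{0<..<t}|lborel. f (t - \<tau>) * g \<tau>)"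

text \<open>
  \<open>lconv_prod F k\<close> is \<open>F 1 * \<dots> * F k\<close>, bracketed to the left, for \<open>k \<ge> 1\<close>. The empty
  convolution product is left unspecified, since the convolution has no unit among functions.
\<close>

fun lconv_prod :: "(nat \<Rightarrow> real \<Rightarrow> real) \<Rightarrow> nat \<Rightarrow> real \<Rightarrow> real" where
  "lconv_prod F (Suc 0) = F 1"
| "lconv_prod F (Suc (Suc k)) = lconv (lconv_prod F (Suc k)) (F (Suc (Suc k)))"

definition lconv_power :: "(real \<Rightarrow> real) \<Rightarrow> nat \<Rightarrow> real \<Rightarrow> real" where
  "lconv_power f k = lconv_prod (\<lambda>_. f) k"

abbreviation one_pow :: "nat \<Rightarrow> real \<Rightarrow> real" where
  "one_pow k \<equiv> lconv_power (\<lambda>_. 1) k"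

lemma one_pow_eq:
  assumes "k \<ge> 1" "t > 0"
  shows "one_pow k t = t ^ (k - 1) / fact (k - 1)"
  using assms
proof (induction k arbitrary: t rule: nat_induct_at_least)
  case base
  then show ?case by (simp add: lconv_power_def)
next
  case (Suc k)
  then obtain j where k: "k = Suc j"
    by (cases k) auto
  define F where "F x = - ((t - x) ^ k / (real k * fact (k - 1)))" for x :: real
  have "one_pow (Suc k) t = (LINT \<tau>:{0<..<t}|lborel. one_pow k (t - \<tau>))"
    by (simp add: k lconv_power_def lconv_def)
  also have "\<dots> = (LINT \<tau>:{0<..<t}|lborel. (t - \<tau>) ^ (k - 1) / fact (k - 1))"
    using Suc.IH by (intro set_lebesgue_integral_cong) auto
  also have "\<dots> = (LBINT \<tau>=ereal 0..ereal t. (t - \<tau>) ^ (k - 1) / fact (k - 1))"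
    using Suc.prems by (simp add: interval_lebesgue_integral_def einterval_eq)
  also have "\<dots> = F t - F 0"
  proof (rule interval_integral_FTC_finite)
    show "continuous_on {min 0 t..max 0 t} (\<lambda>\<tau>. (t - \<tau>) ^ (k - 1) / fact (k - 1))"
      by (intro continuous_intros) auto
    show "(F has_vector_derivative (t - x) ^ (k - 1) / fact (k - 1))
            (at x within {min 0 t..max 0 t})" for x
      unfolding F_def has_real_derivative_iff_has_vector_derivative[symmetric]
      using Suc.hyps by (auto intro!: derivative_eq_intros)
  qed
  also have "\<dots> = t ^ (Suc k - 1) / fact (Suc k - 1)"
    by (simp add: F_def k)
  finally show ?case .
qed

definition Luchko_set :: "nat \<Rightarrow> ((real \<Rightarrow> real) \<times> (real \<Rightarrow> real)) set" where
  "Luchko_set n = {(M, N). M \<in> C_minus_one \<and> N \<in> C_minus_one \<and>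
     (\<forall>t>0. lconv M N t = one_pow n t)}"

end

theory Submission
  imports Defs
begin

text \<open>
  Luchko pairs form a graded structure: for \<open>a, b \<ge> 1\<close>, componentwise convolution sends
  \<open>Luchko_set a \<times> Luchko_set b\<close> into \<open>Luchko_set (a + b)\<close>, because convolution is commutative and
  associative on \<open>C_minus_one\<close> and hence
  \<open>(M\<^sub>1 * M\<^sub>2) * (N\<^sub>1 * N\<^sub>2) = (M\<^sub>1 * N\<^sub>1) * (M\<^sub>2 * N\<^sub>2) = {1}\<^sup>a * {1}\<^sup>b = {1}\<^sup>a\<^sup>+\<^sup>b\<close>
  (lemma \<open>Luchko_set_lconv\<close>). Iterating this places the two \<open>p\<close>-fold products in
  \<open>Luchko_set \<eta>\<close>. The powers \<open>({1}\<^sup>n\<^sup>-\<^sup>l, {1}\<^sup>l\<^sup>-\<^sup>\<eta>)\<close> form a Luchko pair of degree \<open>n - \<eta>\<close>, and one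
  more multiplication gives degree \<open>n\<close>.

  The analytic content is that \<open>C_minus_one\<close> is closed under convolution
  (lemma \<open>C_minus_one_lconv\<close>) and that convolution is associative there
  (lemma \<open>lconv_assoc\<close>). For the former, the substitution \<open>\<tau> = t s\<close> takes a power of \<open>t\<close> out of
  the integral and leaves an integral over the unit interval that is dominated by a Beta integral
  and depends continuously on \<open>t\<close>. The latter is Fubini's theorem; its integrability hypothesis
  is closure and integrability applied to absolute values.
\<close>

section \<open>Convolution as an integral over the whole line\<close>

text \<open>
  Extending functions by zero to the left of the origin makes the domain of integration of
  the convolution independent of \<open>t\<close>, so that translations, reflections and Fubini's theorem apply
  without tracking limits of integration.
\<close>

definition causal :: "(real \<Rightarrow> real) \<Rightarrow> real \<Rightarrow> real" where
  "causal f x = indicator {0<..} x * f x"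

lemma lconv_eq_causal: "lconv f g t = (\<integral>x. causal f (t - x) * causal g x \<partial>lborel)"
  unfolding lconv_def set_lebesgue_integral_def causal_def
  by (intro Bochner_Integration.integral_cong) (auto simp: indicator_def)

text \<open>
  A convolution already vanishes on the left half-line, so that an iterated convolution unfolds
  to an iterated integral without an inner cut-off.
\<close>

lemma causal_lconv: "causal (lconv f g) = lconv f g"
proof
  fix t :: real
  show "causal (lconv f g) t = lconv f g t"
    by (cases "t > 0") (simp_all add: causal_def lconv_def set_lebesgue_integral_def)
qed

lemma causal_abs: "causal (\<lambda>x. \<bar>f x\<bar>) x = \<bar>causal f x\<bar>"
  by (simp add: causal_def abs_mult)

lemma lconv_cong:
  assumes "\<And>t. t > 0 \<Longrightarrow> f t = f' t" and "\<And>t. t > 0 \<Longrightarrow> g t = g' t"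
  shows "lconv f g = lconv f' g'"
proof -
  have "causal f = causal f'" and "causal g = causal g'"
    using assms by (auto simp: causal_def indicator_def fun_eq_iff)
  then show ?thesis
    by (simp add: lconv_eq_causal fun_eq_iff)
qed

lemma lconv_commute: "lconv f g = lconv g f"
proof
  fix t :: real
  \<comment> \<open>the reflection \<open>x \<mapsto> t - x\<close>, in the form \<open>x \<mapsto> t + c x\<close> with \<open>c = -1\<close>\<close>
  have "lconv f g t = \<bar>-1\<bar> *\<^sub>R (\<integral>x. causal f (t - (t + -1 * x)) * causal g (t + -1 * x) \<partial>lborel)"
    unfolding lconv_eq_causal by (rule lborel_integral_real_affine) simp
  also have "\<dots> = lconv g f t"
    by (simp add: lconv_eq_causal mult.commute)
  finally show "lconv f g t = lconv g f t" .
qed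

section \<open>Closure of the function space under convolution\<close>

text \<open>
  A continuous factor on the closed half-line extends constantly to the left, so that it may be
  taken continuous, hence Borel measurable, on the whole line.
\<close>

lemma C_minus_oneE:
  assumes "f \<in> C_minus_one"
  obtains q g where "q > -1" "continuous_on UNIV g" "\<And>t. t > 0 \<Longrightarrow> f t = t powr q * g t"
proof -
  from assms obtain q g where q: "q > -1" and g: "continuous_on {0..} g"
    and f: "\<And>t. t > 0 \<Longrightarrow> f t = t powr q * g t"
    unfolding C_minus_one_def by blast
  have "continuous_on UNIV (\<lambda>x. g (max 0 x))"
    by (rule continuous_on_compose2[OF g]) (auto intro!: continuous_intros)
  then show ?thesis
    using that[of q "\<lambda>x. g (max 0 x)"] q f by simp
qed

lemma C_minus_oneI:
  assumes "q > -1" "continuous_on {0..} g" "\<And>t. t > 0 \<Longrightarrow> f t = t powr q * g t"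
  shows "f \<in> C_minus_one"
  using assms unfolding C_minus_one_def by blast

lemma C_minus_one_abs:
  assumes "f \<in> C_minus_one"
  shows "(\<lambda>x. \<bar>f x\<bar>) \<in> C_minus_one"
proof -
  from assms obtain q g where "q > -1" "continuous_on UNIV g"
    and f: "\<And>t. t > 0 \<Longrightarrow> f t = t powr q * g t"
    by (rule C_minus_oneE) blast
  then show ?thesis
    by (intro C_minus_oneI[of q "\<lambda>x. \<bar>g x\<bar>"])
       (auto simp: abs_mult intro!: continuous_intros intro: continuous_on_subset)
qed

lemma C_minus_one_one: "(\<lambda>_. 1) \<in> C_minus_one"
  by (rule C_minus_oneI[of 0 "\<lambda>_. 1"]) auto

lemma causal_measurable:
  assumes "f \<in> C_minus_one"
  shows "causal f \<in> borel_measurable borel"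
proof -
  from assms obtain q g where "continuous_on UNIV g"
    and f: "\<And>t. t > 0 \<Longrightarrow> f t = t powr q * g t"
    by (rule C_minus_oneE) blast
  then have [measurable]: "g \<in> borel_measurable borel"
    by (simp add: borel_measurable_continuous_onI)
  have "causal f = (\<lambda>x. indicator {0<..} x * (x powr q * g x))"
    using f by (auto simp: causal_def indicator_def fun_eq_iff)
  then show ?thesis
    by simp
qed

definition beta_kernel :: "real \<Rightarrow> real \<Rightarrow> real \<Rightarrow> real" where
  "beta_kernel a b s = indicator {0<..<1} s * ((1 - s) powr a * s powr b)"

lemma beta_kernel_nonneg: "beta_kernel a b s \<ge> 0"
  by (simp add: beta_kernel_def)

lemma integrable_beta_kernel:
  assumes "a > -1" "b > -1"
  shows "integrable lborel (beta_kernel a b)"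
proof -
  have "((\<lambda>s. s powr ((b + 1) - 1) * (1 - s) powr ((a + 1) - 1)) has_integral Beta (b + 1) (a + 1)) {0..1}"
    using assms by (intro has_integral_Beta_real) auto
  then have "(\<lambda>s. (1 - s) powr a * s powr b) absolutely_integrable_on {0..1}"
    by (intro nonnegative_absolutely_integrable_1) (auto simp: mult.commute has_integral_iff)
  then have "(\<lambda>s. (1 - s) powr a * s powr b) absolutely_integrable_on {0<..<1}"
    by (rule set_integrable_subset) auto
  then have "integrable lebesgue (beta_kernel a b)"
    by (simp add: set_integrable_def beta_kernel_def[abs_def])
  moreover have "beta_kernel a b \<in> borel_measurable lborel"
    unfolding beta_kernel_def[abs_def] by measurable
  ultimately show ?thesis
    by (simp add: integrable_completion)
qed

text \<open>
  A single bound valid for all \<open>t\<close> in a bounded range gives both integrability and, by dominated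
  convergence, continuity of the rescaled convolution.
\<close>

lemma scaled_integrand_bound:
  fixes g h :: "real \<Rightarrow> real"
  assumes "continuous_on UNIV g" "continuous_on UNIV h"
  obtains C where "\<And>t s. t \<in> {0..T} \<Longrightarrow>
    \<bar>beta_kernel a b s * (g (t * (1 - s)) * h (t * s))\<bar> \<le> C * beta_kernel a b s"
proof -
  have bdd: "\<exists>B. \<forall>x\<in>{0..T}. \<bar>k x\<bar> \<le> B" if "continuous_on UNIV k" for k :: "real \<Rightarrow> real"
  proof -
    have "compact (k ` {0..T})"
      using that by (intro compact_continuous_image) (auto intro: continuous_on_subset)
    then have "bounded (k ` {0..T})"
      by (rule compact_imp_bounded)
    then show ?thesis
      unfolding bounded_iff by auto
  qed
  obtain G H where G: "\<And>x. x \<in> {0..T} \<Longrightarrow> \<bar>g x\<bar> \<le> G" and H: "\<And>x. x \<in> {0..T} \<Longrightarrow> \<bar>h x\<bar> \<le> H"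
    using bdd assms by meson
  show ?thesis
  proof (rule that[of "G * H"])
    fix t s :: real
    assume t: "t \<in> {0..T}"
    show "\<bar>beta_kernel a b s * (g (t * (1 - s)) * h (t * s))\<bar> \<le> G * H * beta_kernel a b s"
    proof (cases "s \<in> {0<..<1}")
      case True
      have "t * x \<in> {0..T}" if "0 \<le> x" "x \<le> 1" for x
        using t that mult_left_le[of x t] by auto
      then have g: "\<bar>g (t * (1 - s))\<bar> \<le> G" and h: "\<bar>h (t * s)\<bar> \<le> H"
        using True by (auto intro: G H)
      have "\<bar>g (t * (1 - s))\<bar> * \<bar>h (t * s)\<bar> \<le> G * H"
        by (rule mult_mono[OF g h]) (use g in linarith, simp)
      then have "beta_kernel a b s * (\<bar>g (t * (1 - s))\<bar> * \<bar>h (t * s)\<bar>)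
          \<le> beta_kernel a b s * (G * H)"
        by (rule mult_left_mono) (rule beta_kernel_nonneg)
      then show ?thesis
        using beta_kernel_nonneg[of a b s] by (simp add: abs_mult mult.commute)
    qed (simp add: beta_kernel_def)
  qed
qed

lemma integrable_scaled_integrand:
  fixes g h :: "real \<Rightarrow> real"
  assumes "a > -1" "b > -1" and g: "continuous_on UNIV g" and h: "continuous_on UNIV h" and "t \<ge> 0"
  shows "integrable lborel (\<lambda>s. beta_kernel a b s * (g (t * (1 - s)) * h (t * s)))"
proof -
  obtain C where C: "\<And>u s. u \<in> {0..t} \<Longrightarrow>
    \<bar>beta_kernel a b s * (g (u * (1 - s)) * h (u * s))\<bar> \<le> C * beta_kernel a b s"
    using scaled_integrand_bound[OF g h] by blast
  have [measurable]: "g \<in> borel_measurable borel" "h \<in> borel_measurable borel"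
    using g h by (auto intro: borel_measurable_continuous_onI)
  show ?thesis
  proof (rule Bochner_Integration.integrable_bound)
    show "integrable lborel (\<lambda>s. C * beta_kernel a b s)"
      using assms by (simp add: integrable_beta_kernel)
    show "(\<lambda>s. beta_kernel a b s * (g (t * (1 - s)) * h (t * s))) \<in> borel_measurable lborel"
      unfolding beta_kernel_def by measurable
    show "AE s in lborel. norm (beta_kernel a b s * (g (t * (1 - s)) * h (t * s)))
        \<le> norm (C * beta_kernel a b s)"
      unfolding real_norm_def using \<open>t \<ge> 0\<close>
      by (intro AE_I2 order_trans[OF C abs_ge_self]) simp
  qed
qed

lemma continuous_on_scaled_integral:
  fixes g h :: "real \<Rightarrow> real"
  assumes "a > -1" "b > -1" and g: "continuous_on UNIV g" and h: "continuous_on UNIV h"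
  shows "continuous_on {0..} (\<lambda>t. \<integral>s. beta_kernel a b s * (g (t * (1 - s)) * h (t * s)) \<partial>lborel)"
  unfolding continuous_on_sequentially o_def
proof (intro ballI allI impI; elim conjE)
  fix u :: "nat \<Rightarrow> real" and t
  assume t: "t \<in> {0..}" and u: "\<forall>n. u n \<in> {0..}" and lim: "u \<longlonglongrightarrow> t"
  then have "bounded (range u)"
    using convergent_imp_bounded by blast
  then obtain T where T: "\<And>n. u n \<in> {0..T}"
    using u unfolding bounded_iff by (force simp: abs_le_iff)
  obtain C where C: "\<And>t s. t \<in> {0..T} \<Longrightarrow>
    \<bar>beta_kernel a b s * (g (t * (1 - s)) * h (t * s))\<bar> \<le> C * beta_kernel a b s"
    using scaled_integrand_bound[OF g h] by blast
  have [measurable]: "g \<in> borel_measurable borel" "h \<in> borel_measurable borel"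
    using g h by (auto intro: borel_measurable_continuous_onI)
  show "(\<lambda>n. \<integral>s. beta_kernel a b s * (g (u n * (1 - s)) * h (u n * s)) \<partial>lborel)
    \<longlonglongrightarrow> (\<integral>s. beta_kernel a b s * (g (t * (1 - s)) * h (t * s)) \<partial>lborel)"
  proof (rule integral_dominated_convergence[where w = "\<lambda>s. C * beta_kernel a b s"])
    show "integrable lborel (\<lambda>s. C * beta_kernel a b s)"
      using assms by (simp add: integrable_beta_kernel)
    have "isCont g x" "isCont h x" for x
      using g h by (auto simp: continuous_on_eq_continuous_at)
    then have "(\<lambda>n. g (u n * (1 - s))) \<longlonglongrightarrow> g (t * (1 - s))" "(\<lambda>n. h (u n * s)) \<longlonglongrightarrow> h (t * s)" for s
      by (auto intro!: isCont_tendsto_compose[where g = g] isCont_tendsto_compose[where g = h]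
          tendsto_intros lim)
    then show "AE s in lborel. (\<lambda>n. beta_kernel a b s * (g (u n * (1 - s)) * h (u n * s)))
        \<longlonglongrightarrow> beta_kernel a b s * (g (t * (1 - s)) * h (t * s))"
      by (intro AE_I2 tendsto_intros)
    show "AE s in lborel. norm (beta_kernel a b s * (g (u n * (1 - s)) * h (u n * s)))
        \<le> C * beta_kernel a b s" for n
      using C[OF T] by simp
  qed (simp_all add: beta_kernel_def)
qed

lemma causal_product_rescaled:
  assumes "t > 0" and f: "\<And>t. t > 0 \<Longrightarrow> f t = t powr a * g t"
    and k: "\<And>t. t > 0 \<Longrightarrow> k t = t powr b * h t"
  shows "causal f (t - t * s) * causal k (t * s) =
    t powr (a + b) * (beta_kernel a b s * (g (t * (1 - s)) * h (t * s)))"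
proof (cases "s \<in> {0<..<1}")
  case True
  then have pos: "t * (1 - s) > 0" "t * s > 0"
    using \<open>t > 0\<close> by simp_all
  have "causal f (t - t * s) * causal k (t * s) = f (t * (1 - s)) * k (t * s)"
    using pos by (simp add: causal_def right_diff_distrib)
  also have "\<dots> = (t * (1 - s)) powr a * g (t * (1 - s)) * ((t * s) powr b * h (t * s))"
    using pos by (simp only: f k)
  also have "\<dots> = t powr (a + b) * (beta_kernel a b s * (g (t * (1 - s)) * h (t * s)))"
    using True \<open>t > 0\<close> by (simp add: beta_kernel_def powr_mult powr_add mult_ac)
  finally show ?thesis .
next
  case False
  then have "t - t * s \<le> 0 \<or> t * s \<le> 0"
    using \<open>t > 0\<close> by (auto simp: mult_le_0_iff)
  with False show ?thesis
    by (auto simp: causal_def beta_kernel_def)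
qed

lemma integrable_lconv:
  assumes "f \<in> C_minus_one" "k \<in> C_minus_one"
  shows "integrable lborel (\<lambda>x. causal f (t - x) * causal k x)"
proof (cases "t > 0")
  case True
  obtain a g where a: "a > -1" and g: "continuous_on UNIV g"
    and f: "\<And>t. t > 0 \<Longrightarrow> f t = t powr a * g t"
    using assms(1) by (rule C_minus_oneE) blast
  obtain b h where b: "b > -1" and h: "continuous_on UNIV h"
    and k: "\<And>t. t > 0 \<Longrightarrow> k t = t powr b * h t"
    using assms(2) by (rule C_minus_oneE) blast
  have "integrable lborel (\<lambda>s. causal f (t - (0 + t * s)) * causal k (0 + t * s))"
    using True integrable_scaled_integrand[OF a b g h, of t]
    by (simp add: causal_product_rescaled[OF True f k])
  then show ?thesis
    using lborel_integrable_real_affine_iff[of t "\<lambda>x. causal f (t - x) * causal k x" 0] True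
    by simp
next
  case False
  then have "(\<lambda>x. causal f (t - x) * causal k x) = (\<lambda>x. 0)"
    by (auto simp: causal_def indicator_def fun_eq_iff)
  then show ?thesis
    by simp
qed

text \<open>
  The exponents \<open>a, b > -1\<close> of the factors combine to \<open>a + b + 1 > -1\<close>: the Jacobian of
  \<open>x = t s\<close> contributes the extra power of \<open>t\<close>.
\<close>

lemma C_minus_one_lconv:
  assumes "f \<in> C_minus_one" "k \<in> C_minus_one"
  shows "lconv f k \<in> C_minus_one"
proof -
  obtain a g where a: "a > -1" and g: "continuous_on UNIV g"
    and f: "\<And>t. t > 0 \<Longrightarrow> f t = t powr a * g t"
    using assms(1) by (rule C_minus_oneE) blast
  obtain b h where b: "b > -1" and h: "continuous_on UNIV h"
    and k: "\<And>t. t > 0 \<Longrightarrow> k t = t powr b * h t"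
    using assms(2) by (rule C_minus_oneE) blast
  show ?thesis
  proof (rule C_minus_oneI[where q = "a + b + 1", OF _ continuous_on_scaled_integral[OF a b g h]])
    show "a + b + 1 > -1"
      using a b by simp
    fix t :: real
    assume t: "t > 0"
    have "lconv f k t = \<bar>t\<bar> *\<^sub>R (\<integral>s. causal f (t - (0 + t * s)) * causal k (0 + t * s) \<partial>lborel)"
      unfolding lconv_eq_causal by (rule lborel_integral_real_affine) (use t in simp)
    also have "\<dots> = t * (t powr (a + b) *
        (\<integral>s. beta_kernel a b s * (g (t * (1 - s)) * h (t * s)) \<partial>lborel))"
      using t by (simp add: causal_product_rescaled[OF t f k])
    also have "\<dots> = t powr (a + b + 1) *
        (\<integral>s. beta_kernel a b s * (g (t * (1 - s)) * h (t * s)) \<partial>lborel)"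
      using t by (simp only: powr_add powr_one mult_ac)
    finally show "lconv f k t = t powr (a + b + 1) *
        (\<integral>s. beta_kernel a b s * (g (t * (1 - s)) * h (t * s)) \<partial>lborel)" .
  qed
qed

section \<open>Associativity\<close>

text \<open>
  Both triple products integrate \<open>f (t - u) g (u - x) h x\<close> over the plane. Integrating the absolute
  value in \<open>x\<close> gives \<open>\<bar>f (t - u)\<bar>\<close> times the convolution of \<open>\<bar>g\<bar>\<close> and \<open>\<bar>h\<bar>\<close> at \<open>u\<close>, which is
  integrable in \<open>u\<close> because \<open>C_minus_one\<close> is closed under absolute values and convolution.
\<close>

lemma lconv_assoc:
  assumes f: "f \<in> C_minus_one" and g: "g \<in> C_minus_one" and h: "h \<in> C_minus_one"
  shows "lconv (lconv f g) h = lconv f (lconv g h)"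
proof
  fix t :: real
  define F where "F = (\<lambda>(u, x). causal f (t - u) * (causal g (u - x) * causal h x))"
  note [measurable] = causal_measurable[OF f] causal_measurable[OF g] causal_measurable[OF h]
  have "integrable (lborel \<Otimes>\<^sub>M lborel) F"
  proof (rule lborel_pair.Fubini_integrable)
    show "F \<in> borel_measurable (lborel \<Otimes>\<^sub>M lborel)"
      unfolding F_def by measurable
    have "(\<integral>x. norm (F (u, x)) \<partial>lborel) =
        causal (\<lambda>x. \<bar>f x\<bar>) (t - u) * causal (lconv (\<lambda>x. \<bar>g x\<bar>) (\<lambda>x. \<bar>h x\<bar>)) u" for u
      by (simp add: F_def causal_lconv lconv_eq_causal causal_abs abs_mult)
    then show "integrable lborel (\<lambda>u. \<integral>x. norm (F (u, x)) \<partial>lborel)"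
      using integrable_lconv[OF C_minus_one_abs[OF f]
          C_minus_one_lconv[OF C_minus_one_abs[OF g] C_minus_one_abs[OF h]]] by simp
    show "AE u in lborel. integrable lborel (\<lambda>x. F (u, x))"
      by (simp add: F_def integrable_lconv[OF g h])
  qed
  then have swap: "(\<integral>x. (\<integral>u. F (u, x) \<partial>lborel) \<partial>lborel) = (\<integral>u. (\<integral>x. F (u, x) \<partial>lborel) \<partial>lborel)"
    using lborel_pair.Fubini_integral[of "\<lambda>u x. F (u, x)"] by simp
  have inner: "(\<integral>u. F (u, x) \<partial>lborel) = causal (lconv f g) (t - x) * causal h x" for x
  proof -
    \<comment> \<open>the translation \<open>u = x + y\<close> turns the inner integral into \<open>f * g\<close> at \<open>t - x\<close>\<close>
    have "(\<integral>u. F (u, x) \<partial>lborel) = \<bar>1\<bar> *\<^sub>R (\<integral>y. F (x + 1 * y, x) \<partial>lborel)"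
      by (rule lborel_integral_real_affine) simp
    also have "\<dots> = (\<integral>y. causal f (t - x - y) * causal g y * causal h x \<partial>lborel)"
      by (simp add: F_def diff_diff_eq mult.assoc)
    also have "\<dots> = causal (lconv f g) (t - x) * causal h x"
      by (simp add: causal_lconv lconv_eq_causal)
    finally show ?thesis .
  qed
  have "lconv (lconv f g) h t = (\<integral>u. (\<integral>x. F (u, x) \<partial>lborel) \<partial>lborel)"
    using swap by (simp add: lconv_eq_causal[of "lconv f g"] inner)
  also have "\<dots> = lconv f (lconv g h) t"
    by (simp add: F_def lconv_eq_causal[of f] causal_lconv lconv_eq_causal[of g])
  finally show "lconv (lconv f g) h t = lconv f (lconv g h) t" .
qed

lemma lconv_lconv_swap:
  assumes "f \<in> C_minus_one" "g \<in> C_minus_one" "h \<in> C_minus_one" "k \<in> C_minus_one"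
  shows "lconv (lconv f g) (lconv h k) = lconv (lconv f h) (lconv g k)"
proof -
  have assoc: "lconv (lconv f x) (lconv y k) = lconv f (lconv (lconv x y) k)"
    if "x \<in> C_minus_one" "y \<in> C_minus_one" for x y
    using that assms by (simp only: lconv_assoc C_minus_one_lconv)
  show ?thesis
    unfolding assoc[OF assms(2,3)] assoc[OF assms(3,2)] lconv_commute[of g h] by (rule refl)
qed

section \<open>The grading of Luchko pairs\<close>

lemma one_pow_Suc:
  assumes "k \<ge> 1"
  shows "one_pow (Suc k) = lconv (one_pow k) (\<lambda>_. 1)"
  using assms by (cases k) (simp_all add: lconv_power_def fun_eq_iff)

lemma one_pow_C_minus_one:
  assumes "k \<ge> 1"
  shows "one_pow k \<in> C_minus_one"
  using assms
proof (induction k rule: nat_induct_at_least)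
  case base
  then show ?case
    by (simp add: lconv_power_def[abs_def] C_minus_one_one)
next
  case (Suc k)
  then show ?case
    by (simp add: one_pow_Suc C_minus_one_lconv C_minus_one_one)
qed

lemma lconv_one_pow:
  assumes "a \<ge> 1" "b \<ge> 1"
  shows "lconv (one_pow a) (one_pow b) = one_pow (a + b)"
  using \<open>b \<ge> 1\<close>
proof (induction b rule: nat_induct_at_least)
  case base
  have "one_pow 1 = (\<lambda>_. 1)"
    by (simp add: lconv_power_def[abs_def])
  then show ?case
    using one_pow_Suc[OF \<open>a \<ge> 1\<close>] by simp
next
  case (Suc b)
  have "lconv (one_pow a) (one_pow (Suc b)) = lconv (one_pow a) (lconv (one_pow b) (\<lambda>_. 1))"
    by (simp only: one_pow_Suc[OF Suc.hyps])
  also have "\<dots> = lconv (lconv (one_pow a) (one_pow b)) (\<lambda>_. 1)"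
    using \<open>a \<ge> 1\<close> Suc.hyps
    by (intro lconv_assoc[symmetric] one_pow_C_minus_one C_minus_one_one)
  also have "\<dots> = one_pow (a + Suc b)"
    using \<open>a \<ge> 1\<close> Suc.IH by (simp add: one_pow_Suc)
  finally show ?case .
qed

lemma one_pow_Luchko_set:
  assumes "a \<ge> 1" "b \<ge> 1"
  shows "(one_pow a, one_pow b) \<in> Luchko_set (a + b)"
  using assms by (simp add: Luchko_set_def one_pow_C_minus_one lconv_one_pow)

lemma Luchko_set_lconv:
  assumes "(M, N) \<in> Luchko_set a" "(M', N') \<in> Luchko_set b" "a \<ge> 1" "b \<ge> 1"
  shows "(lconv M M', lconv N N') \<in> Luchko_set (a + b)"
proof -
  have "lconv (lconv M M') (lconv N N') = lconv (lconv M N) (lconv M' N')"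
    using assms by (intro lconv_lconv_swap) (auto simp: Luchko_set_def)
  also have "\<dots> = lconv (one_pow a) (one_pow b)"
    using assms by (intro lconv_cong) (auto simp: Luchko_set_def)
  also have "\<dots> = one_pow (a + b)"
    using assms by (intro lconv_one_pow)
  finally show ?thesis
    using assms by (auto simp: Luchko_set_def C_minus_one_lconv)
qed

lemma Luchko_set_lconv_prod:
  assumes "p \<ge> 1" "\<And>j. j \<in> {1..p} \<Longrightarrow> m j \<ge> 1"
    and "\<And>j. j \<in> {1..p} \<Longrightarrow> (M j, N j) \<in> Luchko_set (m j)"
  shows "(lconv_prod M p, lconv_prod N p) \<in> Luchko_set (\<Sum>j=1..p. m j)"
  using assms
proof (induction p rule: nat_induct_at_least)
  case base
  then show ?case
    by simp
next
  case (Suc p)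
  have "m 1 \<le> (\<Sum>j=1..p. m j)"
    using Suc.hyps by (intro member_le_sum) auto
  moreover have "m 1 \<ge> 1"
    using Suc.prems(1)[of 1] by simp
  ultimately have "(\<Sum>j=1..p. m j) \<ge> 1"
    by linarith
  then have "(lconv (lconv_prod M p) (M (Suc p)), lconv (lconv_prod N p) (N (Suc p)))
      \<in> Luchko_set ((\<Sum>j=1..p. m j) + m (Suc p))"
    using Suc by (intro Luchko_set_lconv) auto
  then show ?case
    using Suc.hyps by (cases p) simp_all
qed

theorem theorem5:
  fixes p n l \<eta> :: nat
    and m :: "nat \<Rightarrow> nat"
    and M N :: "nat \<Rightarrow> real \<Rightarrow> real"
  assumes "p \<ge> 1"
    and "\<And>j. j \<in> {1..p} \<Longrightarrow> m j \<ge> 1"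
    and "\<And>j. j \<in> {1..p} \<Longrightarrow> (M j, N j) \<in> Luchko_set (m j)"
    and "\<eta> = (\<Sum>j=1..p. m j)"
    and "n \<ge> 1" and "l \<ge> 1"
    and "1 \<le> \<eta>" and "\<eta> \<le> n - 1"
    and "\<eta> + 1 \<le> l" and "l \<le> n - 1"
  shows "(lconv (one_pow (n - l)) (lconv_prod M p),
          lconv (one_pow (l - \<eta>)) (lconv_prod N p)) \<in> Luchko_set n"
proof -
  have "(lconv_prod M p, lconv_prod N p) \<in> Luchko_set \<eta>"
    unfolding \<open>\<eta> = _\<close> using assms(1-3) by (rule Luchko_set_lconv_prod)
  moreover have "(one_pow (n - l), one_pow (l - \<eta>)) \<in> Luchko_set ((n - l) + (l - \<eta>))"
    using assms(5-10) by (intro one_pow_Luchko_set) auto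
  ultimately have "(lconv (one_pow (n - l)) (lconv_prod M p),
      lconv (one_pow (l - \<eta>)) (lconv_prod N p)) \<in> Luchko_set ((n - l) + (l - \<eta>) + \<eta>)"
    using assms(5-10) by (intro Luchko_set_lconv) auto
  moreover have "(n - l) + (l - \<eta>) + \<eta> = n"
    using assms(5-10) by auto
  ultimately show ?thesis
    by simp
qed

end
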